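(* The well-ordered set $(\mathcal{T},\geq)$, where $\mathcal{T}=\{t(\mathbf{k}) : \mathbf{k} \text{ a (nonempty) admissible multi-index}\}$, has order type $\omega^{2}$, where $\omega$ is the smallest infinite ordinal.
   Context: An admissible multi-index is a finite sequence $\mathbf{k}=(k_1,\ldots,k_d)$, $d\ge1$, of positive integers with $k_1>1$. The multiple $t$-value is $t(\mathbf{k})=\sum_{m_1>\cdots>m_d>0}\prod_{i=1}^d (2m_i-1)^{-k_i}$. The order type refers to $\mathcal{T}$ ordered so that larger real numbers come first. *)

theory Defs
  imports "HOL-Analysis.Infinite_Sum"
begin

text \<open>A multi-index $(k_1,\ldots,k_d)$ is a list, with $k_1$ at the head.\<close>

definition admissible :: "nat list \<Rightarrow> bool" where
  "admissible ks \<longleftrightarrow> ks \<noteq> [] \<and> (\<forall>k\<in>set ks. k > 0) \<and> hd ks > 1"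

text \<open>
  The tuples $m_1 > \cdots > m_d > 0$ are the strictly decreasing lists of positive
  naturals of length $d$. For admissible \<open>ks\<close> the series has positive terms and
  converges, so the unordered sum \<^const>\<open>infsum\<close> is its value.
\<close>

definition mtv :: "nat list \<Rightarrow> real" where
  "mtv ks = (\<Sum>\<^sub>\<infinity>ms\<in>{ms :: nat list. length ms = length ks \<and> sorted_wrt (>) ms \<and> (\<forall>m\<in>set ms. m > 0)}.
     \<Prod>i<length ks. 1 / (2 * real (ms ! i) - 1) ^ (ks ! i))"

definition mtv_set :: "real set" where
  "mtv_set = {mtv ks | ks. admissible ks}"

text \<open>
  Well-orders are reflexive relations, as in \<^const>\<open>well_order_on\<close>; a pair \<open>(x, y)\<close> in the
  relation means that \<open>x\<close> comes first, so here larger reals come first.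
\<close>

definition geq_on :: "real set \<Rightarrow> real rel" where
  "geq_on A = {(x, y). x \<in> A \<and> y \<in> A \<and> x \<ge> y}"

text \<open>
  $\omega^2 = \omega\cdot\omega$ as the lexicographic order on pairs of naturals. The first
  component is compared strictly and the second reflexively, so the result is reflexive.
\<close>

definition omega_squared :: "(nat \<times> nat) rel" where
  "omega_squared = less_than <*lex*> natLeq"

end

theory Submission
  imports Defs "HOL-Analysis.Analysis"
begin

text \<open>
  Fix all exponents but the last. As the last exponent grows, the value decreases strictly to
  the partial sum over the tuples with \<open>m\<^sub>d = 1\<close>, which is positive. On the other hand, the
  values with exponents \<open>k\<^sub>1, \<dots>, k\<^sub>d\<close> are bounded by a constant times \<open>(2/3) ^ (k\<^sub>1 + \<dots> + k\<^bsub>d-1\<^esub>)\<close>, so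
  only finitely many of these decreasing sequences reach above a given \<open>\<epsilon> > 0\<close>. Hence the limits
  form an infinite set with order type \<open>\<omega>\<close> under \<open>\<ge>\<close>, and between two consecutive limits the set
  again has order type \<open>\<omega>\<close>.
\<close>

section \<open>Families of decreasing sequences\<close>

text \<open>Counting the elements above \<open>x\<close> gives an injection into the naturals. Its
  image is infinite and closed under predecessors, hence everything, and its inverse is the
  enumeration.\<close>

lemma decreasing_enumeration:
  fixes S :: "'a::linorder set"
  assumes inf: "infinite S" and fin: "\<And>x. x \<in> S \<Longrightarrow> finite {s\<in>S. x \<le> s}"
  shows "\<exists>g::nat \<Rightarrow> 'a. (\<forall>m n. m < n \<longrightarrow> g n < g m) \<and> range g = S"
proof -
  define h where "h x = card {s\<in>S. x < s}" for x
  have fin': "finite {s\<in>S. x < s}" if "x \<in> S" for x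
    by (rule finite_subset[OF _ fin[OF that]]) auto
  have h_less: "h y < h x" if "x \<in> S" "y \<in> S" "x < y" for x y
    unfolding h_def by (rule psubset_card_mono[OF fin'[OF that(1)]]) (use that in auto)
  have inj: "inj_on h S"
    by (rule inj_onI) (metis h_less less_irrefl neq_iff)
  have step: "n \<in> h ` S" if n: "Suc n \<in> h ` S" for n
  proof -
    obtain x where x: "x \<in> S" "h x = Suc n" using n by auto
    \<comment> \<open>The least element above \<open>x\<close> has exactly one element fewer above
      it.\<close>
    define y where "y = Min {s\<in>S. x < s}"
    have ne: "{s\<in>S. x < s} \<noteq> {}"
      using x(2) unfolding h_def by (metis card.empty nat.distinct(1))
    have y: "y \<in> S" "x < y" "\<And>s. s \<in> S \<Longrightarrow> x < s \<Longrightarrow> y \<le> s"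
      using Min_in[OF fin'[OF x(1)] ne] Min_le[OF fin'[OF x(1)]] by (auto simp: y_def)
    have "{s\<in>S. x < s} = insert y {s\<in>S. y < s}"
      using y by force
    then have "h x = Suc (h y)"
      unfolding h_def using fin'[OF y(1)] by simp
    with x y show ?thesis by auto
  qed
  have down: "m \<in> h ` S" if "m \<le> n" "n \<in> h ` S" for m n
    using that by (induction rule: inc_induct) (use step in auto)
  have "infinite (h ` S)" using inf inj finite_imageD by blast
  then have surj: "h ` S = UNIV"
    by (metis UNIV_eq_I down infinite_nat_iff_unbounded_le)
  define g where "g = inv_into S h"
  have g: "g n \<in> S" "h (g n) = n" for n
    using surj by (auto simp: g_def inv_into_into f_inv_into_f)
  have "g n < g m" if "m < n" for m n
    using that g h_less by (metis less_asym' linorder_neqE)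
  moreover have "range g = S"
    using g inj by (auto simp: image_iff) (metis inj_onD)
  ultimately show ?thesis by blast
qed

lemma decreasing_limit_less:
  fixes f :: "nat \<Rightarrow> real"
  assumes dec: "\<And>k. f (Suc k) < f k" and lim: "f \<longlonglongrightarrow> l"
  shows "l < f k"
proof -
  have "decseq f" using dec by (simp add: decseq_SucI less_imp_le)
  from decseq_ge[OF this lim, of "Suc k"] dec[of k] show ?thesis by simp
qed

text \<open>The limits are enumerated as \<open>e 0 > e 1 > ...\<close>, and the part of
  \<open>A\<close> between consecutive limits is enumerated separately. Sequences may interleave,
  share values or share a limit, since only sets of values are enumerated.\<close>

lemma omega_squared_enumeration:
  fixes s :: "'i \<Rightarrow> nat \<Rightarrow> real" and l :: "'i \<Rightarrow> real"
  assumes inf: "infinite I"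
    and dec: "\<And>p k. p \<in> I \<Longrightarrow> s p (Suc k) < s p k"
    and lim: "\<And>p. p \<in> I \<Longrightarrow> s p \<longlonglongrightarrow> l p"
    and pos: "\<And>p. p \<in> I \<Longrightarrow> 0 < l p"
    and fin: "\<And>\<epsilon>. 0 < \<epsilon> \<Longrightarrow> finite {p\<in>I. \<epsilon> \<le> s p 0}"
  defines "A \<equiv> (\<Union>p\<in>I. range (s p))"
  shows "\<exists>g::nat \<times> nat \<Rightarrow> real. range g = A \<and>
    (\<forall>n i n' i'. n < n' \<or> n = n' \<and> i < i' \<longrightarrow> g (n', i') < g (n, i))"
proof -
  have less: "l p < s p k" if "p \<in> I" for p k
    using decreasing_limit_less[of "s p" "l p"] dec lim that by blast
  have anti: "s p k < s p j" if "p \<in> I" "j < k" for p j k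
    using lift_Suc_mono_less[of "\<lambda>k. - s p k" j k] dec that by auto
  have anti_le: "s p k \<le> s p 0" if "p \<in> I" for p k
    using anti[OF that, of 0 k] by (cases k) auto
  define L where "L = l ` I"
  have finL: "finite {p\<in>I. \<epsilon> \<le> l p}" if "0 < \<epsilon>" for \<epsilon>
    by (rule finite_subset[OF _ fin[OF that]]) (auto intro: order.trans[OF _ less_imp_le[OF less]])
  \<comment> \<open>A least limit would be a positive lower bound for all limits, forcing
    \<open>I\<close> to be finite.\<close>
  have "infinite L"
  proof
    assume "finite L"
    moreover have "L \<noteq> {}" using inf by (auto simp: L_def)
    ultimately have "Min L \<in> L" "\<And>x. x \<in> L \<Longrightarrow> Min L \<le> x" by auto
    then have "0 < Min L" "{p\<in>I. Min L \<le> l p} = I" using pos by (auto simp: L_def)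
    with finL[of "Min L"] inf show False by simp
  qed
  moreover have "finite {y\<in>L. x \<le> y}" if "x \<in> L" for x
    by (rule finite_subset[OF _ finite_imageI[OF finL, of x l]]) (use that pos in \<open>auto simp: L_def\<close>)
  ultimately obtain e :: "nat \<Rightarrow> real"
    where e_less: "\<And>m n. m < n \<Longrightarrow> e n < e m" and e_range: "range e = L"
    using decreasing_enumeration[of L] by blast
  have e_ex: "\<exists>p\<in>I. l p = e n" for n
    using rangeI[of e n] unfolding e_range L_def by auto
  have l_ex: "\<exists>m. l p = e m" if "p \<in> I" for p
    using imageI[OF that, of l] unfolding e_range[symmetric] L_def[symmetric] by auto
  have e_pos: "0 < e n" for n using e_ex[of n] pos by force
  have e_le: "e n \<le> e m" if "m \<le> n" for m n
    using e_less[of m n] that by (cases "m = n") auto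
  \<comment> \<open>The blocks are half-open: a value may coincide with a limit \<open>e m\<close>,
    and then it belongs to block \<open>m + 1\<close>. For \<open>n = 0\<close> there is no upper
    bound.\<close>
  define B where "B n = {a\<in>A. e n < a \<and> (\<forall>m<n. a \<le> e m)}" for n
  have "\<exists>g::nat \<Rightarrow> real. (\<forall>i j. i < j \<longrightarrow> g j < g i) \<and> range g = B n" for n
  proof (rule decreasing_enumeration)
    \<comment> \<open>One sequence converging to \<open>e n\<close> suffices: its terms exceed
      \<open>e n\<close> and eventually fall below all earlier limits.\<close>
    obtain p where p: "p \<in> I" "l p = e n" using e_ex by blast
    have "\<forall>\<^sub>F k in sequentially. \<forall>m\<in>{..<n}. s p k < e m"
      using order_tendstoD(2)[OF lim[OF p(1)]] p e_less
      by (intro eventually_ball_finite) auto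
    then obtain K where K: "\<And>k m. k \<ge> K \<Longrightarrow> m < n \<Longrightarrow> s p k < e m"
      by (auto simp: eventually_sequentially)
    have "s p ` {K..} \<subseteq> B n"
      using K less[OF p(1)] p by (auto simp: B_def A_def intro: less_imp_le)
    moreover have "inj_on (s p) {K..}"
      by (rule inj_onI) (metis anti[OF p(1)] less_irrefl neq_iff)
    then have "infinite (s p ` {K..})" by (simp add: finite_image_iff infinite_Ici)
    ultimately show "infinite (B n)" using finite_subset by blast
  next
    fix x assume x: "x \<in> B n"
    then have x_gt: "e n < x" by (simp add: B_def)
    have x_pos: "0 < x" using x_gt e_pos[of n] by simp
    \<comment> \<open>A sequence with limit \<open>e m\<close>, \<open>m < n\<close>, stays above
      \<open>e m\<close> and misses the block. Any other has limit at most \<open>e n < x\<close>,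
      so only finitely many of its terms reach \<open>x\<close>.\<close>
    have fin1: "finite {k. x \<le> s p k \<and> (\<forall>m<n. s p k \<le> e m)}" if p: "p \<in> I" for p
    proof -
      obtain m where m: "l p = e m" using l_ex[OF p] by blast
      show ?thesis
      proof (cases "m < n")
        case True
        then have "{k. x \<le> s p k \<and> (\<forall>m<n. s p k \<le> e m)} = {}"
          using less[OF p] m by (auto simp: not_le)
        then show ?thesis by (simp only: finite.emptyI)
      next
        case False
        then have "l p < x" using e_le[of n m] m x_gt by simp
        then have "\<forall>\<^sub>F k in sequentially. s p k < x" using order_tendstoD(2)[OF lim[OF p]] by blast
        then obtain K where K: "\<And>k. k \<ge> K \<Longrightarrow> s p k < x" by (auto simp: eventually_sequentially)
        have "{k. x \<le> s p k \<and> (\<forall>m<n. s p k \<le> e m)} \<subseteq> {..<K}"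
          using K by (auto simp: not_le[symmetric])
        then show ?thesis using finite_subset by blast
      qed
    qed
    have "{b\<in>B n. x \<le> b} \<subseteq>
      (\<Union>p\<in>{p\<in>I. x \<le> s p 0}. s p ` {k. x \<le> s p k \<and> (\<forall>m<n. s p k \<le> e m)})"
    proof
      fix b assume b: "b \<in> {b\<in>B n. x \<le> b}"
      then obtain p k where p: "p \<in> I" "b = s p k" by (auto simp: B_def A_def)
      then have "x \<le> s p 0" using b anti_le[of p k] by simp
      then show "b \<in> (\<Union>p\<in>{p\<in>I. x \<le> s p 0}. s p ` {k. x \<le> s p k \<and> (\<forall>m<n. s p k \<le> e m)})"
        using b p by (intro UN_I[of p] image_eqI[of _ _ k]) (auto simp: B_def)
    qed
    moreover have "finite \<dots>" using fin[OF x_pos] fin1 by blast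
    ultimately show "finite {b\<in>B n. x \<le> b}" using finite_subset by blast
  qed
  then obtain g :: "nat \<Rightarrow> nat \<Rightarrow> real"
    where g_less: "\<And>n i j. i < j \<Longrightarrow> g n j < g n i" and g_range: "\<And>n. range (g n) = B n"
    by metis
  have gB: "g n i \<in> B n" for n i using g_range by blast
  \<comment> \<open>The block is given by the first limit below \<open>a\<close>; one exists because
    \<open>a\<close> exceeds the limit of its own sequence.\<close>
  have "\<exists>n. a \<in> B n" if a: "a \<in> A" for a
  proof -
    obtain p k where p: "p \<in> I" "a = s p k" using a by (auto simp: A_def)
    obtain m where "l p = e m" using l_ex[OF p(1)] by blast
    with p less have ex: "e m < a" by metis
    have "e (LEAST n. e n < a) < a" using ex by (rule LeastI)
    moreover have "\<forall>m<(LEAST n. e n < a). a \<le> e m" by (auto dest: not_less_Least)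
    ultimately show ?thesis using a by (auto simp: B_def)
  qed
  then have "A = (\<Union>n. B n)" by (auto simp: B_def)
  then have "range (\<lambda>(n, i). g n i) = A"
    by (auto simp flip: g_range)
  \<comment> \<open>Distinct blocks are separated by a limit:
    \<open>g n' i' \<le> e n < g n i\<close> for \<open>n < n'\<close>.\<close>
  moreover have "g n' i' < g n i" if "n < n' \<or> n = n' \<and> i < i'" for n i n' i'
    using that gB[of n' i'] gB[of n i] g_less by (force simp: B_def)
  ultimately show ?thesis by (intro exI[of _ "\<lambda>(n, i). g n i"]) auto
qed

section \<open>Comparison with the lexicographic order\<close>

lemma Well_order_omega_squared: "Well_order omega_squared"
  and Field_omega_squared: "Field omega_squared = UNIV"
proof -
  have refl: "refl omega_squared"
    by (auto simp: refl_on_def omega_squared_def natLeq_def)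
  then show F: "Field omega_squared = UNIV"
    by (auto simp: Field_def refl_on_def)
  have "omega_squared - Id \<subseteq> less_than <*lex*> less_than"
    by (auto simp: omega_squared_def natLeq_def)
  then have "wf (omega_squared - Id)"
    using wf_subset wf_lex_prod[OF wf_less_than wf_less_than] by blast
  moreover have "trans omega_squared" "antisym omega_squared" "total omega_squared"
    by (auto simp: trans_def antisym_def total_on_def omega_squared_def natLeq_def)
  ultimately show "Well_order omega_squared"
    using refl unfolding F
    by (auto simp: well_order_on_def linear_order_on_def partial_order_on_def preorder_on_def)
qed

text \<open>Strict reversal of a total order makes \<open>g\<close> an isomorphism onto
  \<open>geq_on A\<close>; well-foundedness is then pulled back along \<open>inv g\<close>.\<close>

lemma geq_on_ordIso_omega_squared:
  fixes g :: "nat \<times> nat \<Rightarrow> real"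
  assumes range: "range g = A"
    and less: "\<And>n i n' i'. n < n' \<or> n = n' \<and> i < i' \<Longrightarrow> g (n', i') < g (n, i)"
  shows "well_order_on A (geq_on A) \<and> (geq_on A, omega_squared) \<in> ordIso"
proof -
  have iff: "(x, y) \<in> omega_squared \<longleftrightarrow> g y \<le> g x" for x y
  proof (cases x; cases y)
    fix n i n' i' assume "x = (n, i)" "y = (n', i')"
    then show ?thesis
      using less[of n n' i i'] less[of n' n i' i]
      by (cases "n = n'"; cases "i = i'"; cases "n < n'"; cases "i < i'")
        (auto simp: omega_squared_def natLeq_def)
  qed
  have inj: "inj g"
  proof (rule injI)
    fix x y assume "g x = g y"
    then have "(x, y) \<in> omega_squared" "(y, x) \<in> omega_squared" by (simp_all add: iff)
    then show "x = y" by (cases x; cases y) (auto simp: omega_squared_def natLeq_def)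
  qed
  have F: "Field (geq_on A) = A" by (auto simp: Field_def geq_on_def)
  have iso: "iso omega_squared (geq_on A) g"
    unfolding iso_iff2 Field_omega_squared F
    using inj range iff by (auto simp: bij_betw_def geq_on_def)
  have "wf (geq_on A - Id)"
  proof (rule wf_subset)
    show "wf (inv_image (omega_squared - Id) (inv g))"
      using Well_order_omega_squared by (auto simp: well_order_on_def)
    show "geq_on A - Id \<subseteq> inv_image (omega_squared - Id) (inv g)"
      using range inj by (auto simp: geq_on_def iff f_inv_into_f)
  qed
  moreover have "linear_order_on A (geq_on A)"
    by (auto simp: linear_order_on_def partial_order_on_def preorder_on_def refl_on_def
        trans_def antisym_def total_on_def geq_on_def)
  ultimately have wo: "well_order_on A (geq_on A)" by (simp add: well_order_on_def)
  moreover have "(omega_squared, geq_on A) \<in> ordIso"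
    unfolding ordIso_def using iso wo Well_order_omega_squared by (auto simp: F)
  ultimately show ?thesis using ordIso_symmetric by blast
qed

section \<open>Summation over decreasing tuples\<close>

definition tuples :: "nat \<Rightarrow> nat list set" where
  "tuples d = {ms. length ms = d \<and> sorted_wrt (>) ms \<and> (\<forall>m\<in>set ms. m > 0)}"

text \<open>Finite truncations of the index set. The bound is strict so that the tails allowed after
  a head \<open>m\<close> are exactly \<open>tuples_below d m\<close>.\<close>

definition tuples_below :: "nat \<Rightarrow> nat \<Rightarrow> nat list set" where
  "tuples_below d n = {ms\<in>tuples d. \<forall>m\<in>set ms. m < n}"

definition mtv_term :: "nat list \<Rightarrow> nat list \<Rightarrow> real" where
  "mtv_term ks ms = (\<Prod>i<length ks. 1 / (2 * real (ms ! i) - 1) ^ (ks ! i))"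

lemma mtv_eq_infsum: "mtv ks = infsum (mtv_term ks) (tuples (length ks))"
  by (simp add: mtv_def mtv_term_def[abs_def] tuples_def)

lemma mtv_term_Nil [simp]: "mtv_term [] ms = 1"
  by (simp add: mtv_term_def)

lemma mtv_term_Cons [simp]:
  "mtv_term (k # ks) (m # ms) = mtv_term ks ms / (2 * real m - 1) ^ k"
  by (simp add: mtv_term_def prod.lessThan_Suc_shift del: prod.lessThan_Suc)

lemma mtv_term_snoc:
  assumes "length ms = length ks"
  shows "mtv_term (ks @ [k]) (ms @ [m]) = mtv_term ks ms / (2 * real m - 1) ^ k"
  using assms by (simp add: mtv_term_def nth_append)

lemma mtv_term_pos:
  assumes "ms \<in> tuples (length ks)"
  shows "mtv_term ks ms > 0"
  unfolding mtv_term_def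
proof (intro prod_pos ballI)
  fix i assume "i \<in> {..<length ks}"
  then have "ms ! i > 0" using assms by (auto simp: tuples_def)
  then show "1 / (2 * real (ms ! i) - 1) ^ (ks ! i) > 0" by simp
qed

lemma finite_tuples_below: "finite (tuples_below d n)"
  by (rule finite_subset[OF _ finite_lists_length_eq[of "{..<n}" d]])
    (auto simp: tuples_below_def tuples_def)

lemma tuples_below_0 [simp]: "tuples_below 0 n = {[]}"
  by (auto simp: tuples_below_def tuples_def)

lemma tuples_below_Suc:
  "tuples_below (Suc d) n = (\<Union>m\<in>{1..<n}. (#) m ` tuples_below d m)"
  unfolding tuples_below_def tuples_def
  by (auto simp: length_Suc_conv image_iff Suc_le_eq) (meson less_trans)+

lemma tuples_below_Suc_1 [simp]: "tuples_below (Suc d) (Suc 0) = {}"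
  by (simp add: tuples_below_Suc)

text \<open>Sorting by the largest entry gives the recursion behind all estimates of truncated
  sums.\<close>

lemma sum_tuples_below_Cons:
  "sum (mtv_term (k # ks)) (tuples_below (Suc d) n) =
    (\<Sum>m=1..<n. sum (mtv_term ks) (tuples_below d m) / (2 * real m - 1) ^ k)"
  unfolding tuples_below_Suc
  by (subst sum.UNION_disjoint)
    (auto simp: finite_tuples_below sum.reindex inj_on_def sum_divide_distrib)

text \<open>
  With weight \<open>x = 3/2\<close> per entry, \<open>growth m\<close> is the generating function of the sums
  over tuples below \<open>m\<close> with all exponents \<open>1\<close>. Any \<open>1 < x < 2\<close> would do: the bound
  decays geometrically because \<open>x > 1\<close>, and the outer sum converges because \<open>x < 2\<close>.
\<close>

definition growth :: "nat \<Rightarrow> real" where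
  "growth n = (\<Prod>m=1..<n. 1 + (3/2) / (2 * real m - 1))"

lemma growth_1 [simp]: "growth (Suc 0) = 1"
  by (simp add: growth_def)

lemma growth_Suc: "n \<ge> 1 \<Longrightarrow> growth (Suc n) = growth n * (1 + (3/2) / (2 * real n - 1))"
  by (simp add: growth_def prod.atLeastLessThan_Suc)

lemma growth_ge_1: "growth n \<ge> 1"
  unfolding growth_def by (rule prod_ge_1) auto

text \<open>Telescopes: each summand is \<open>growth (Suc m) - growth m\<close>.\<close>

lemma growth_sum_1:
  assumes "n \<ge> 1"
  shows "(\<Sum>m=1..<n. (3/2) * growth m / (2 * real m - 1)) = growth n - 1"
  using assms by (induction rule: dec_induct) (simp_all add: growth_Suc ring_distribs)

text \<open>Telescopes through \<open>growth m / (2 * m - 1)\<close>.\<close>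

lemma growth_sum_2:
  assumes "n \<ge> 1"
  shows "(\<Sum>m=1..<n. growth m / (2 * real m - 1)^2) \<le> 6 - 6 * growth n / (2 * real n - 1)"
  using assms
proof (induction rule: dec_induct)
  case base then show ?case by simp
next
  case (step n)
  define y where "y = 2 * real n - 1"
  have y: "y \<ge> 1" using step by (simp add: y_def)
  have g: "growth n > 0" using growth_ge_1[of n] by simp
  have "growth n / y^2 \<le> 3 * growth n / (y * (y + 2))"
  proof -
    have "y * (y + 2) \<le> 3 * y^2" using y by (simp add: power2_eq_square algebra_simps)
    then have "growth n * (y * (y + 2)) \<le> growth n * (3 * y^2)" using g by simp
    then show ?thesis using y by (simp add: divide_le_eq le_divide_eq ac_simps)
  qed
  \<comment> \<open>Up to the factor \<open>growth n\<close>, the numerator is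
    \<open>6 * ((y + 2) - (y + 3/2)) = 3\<close>. The constant 6 is fitted to
    \<open>y * (y + 2) \<le> 3 * y^2\<close>, which is sharp at \<open>y = 1\<close>.\<close>
  also have "\<dots> = 6 * growth n / y - 6 * (growth n * (1 + (3/2) / y)) / (y + 2)"
  proof -
    have "6 * growth n / y - 6 * (growth n * (1 + (3/2) / y)) / (y + 2) =
        (6 * growth n * (y + 2) - 6 * (growth n * (1 + (3/2) / y)) * y) / (y * (y + 2))"
      using y by (intro diff_frac_eq) auto
    also have "6 * growth n * (y + 2) - 6 * (growth n * (1 + (3/2) / y)) * y = 3 * growth n"
      using y by (simp add: field_simps)
    finally show ?thesis by (rule sym)
  qed
  finally have "growth n / y^2 \<le> 6 * growth n / y - 6 * growth (Suc n) / (y + 2)"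
    using step by (simp add: growth_Suc y_def)
  moreover have "2 * real (Suc n) - 1 = y + 2" by (simp add: y_def)
  ultimately show ?case using step by (simp add: y_def)
qed

text \<open>Since \<open>3/2 / y \<le> 1\<close>, all but \<open>q\<close> factors
  \<open>1 / y\<close> can be traded for factors \<open>2/3\<close>. The \<open>q\<close> factors
  kept serve to sum over \<open>m\<close>, the others give geometric decay.\<close>

lemma inverse_power_le:
  fixes y :: real
  assumes "y \<ge> 3/2" "q \<le> k"
  shows "1 / y ^ k \<le> (3/2) ^ q / y ^ q / (3/2) ^ k"
proof -
  have "(3/2 / y) ^ k \<le> (3/2 / y) ^ q"
    using assms by (intro power_decreasing) auto
  then have "(3/2 / y) ^ k / (3/2) ^ k \<le> (3/2 / y) ^ q / (3/2) ^ k"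
    by (rule divide_right_mono) simp
  then show ?thesis by (simp only: power_divide) simp
qed

text \<open>
  Only the last entry of a tuple can be \<open>1\<close>; for \<open>m = 1\<close> the sum on the left is empty
  unless \<open>ks = []\<close>. This is why the bound involves all exponents except the last.
\<close>

lemma tuples_below_sum_divide_le:
  assumes m: "m \<ge> 1" and q: "q \<le> k"
    and le: "sum (mtv_term ks) (tuples_below (length ks) m) \<le> growth m / (3/2) ^ sum_list (butlast ks)"
  shows "sum (mtv_term ks) (tuples_below (length ks) m) / (2 * real m - 1) ^ k
    \<le> (3/2) ^ q * growth m / (2 * real m - 1) ^ q / (3/2) ^ sum_list (butlast (k # ks))"
proof -
  define y where "y = 2 * real m - 1"
  define Y :: real where "Y = (3/2) ^ sum_list (butlast ks)"
  define S where "S = sum (mtv_term ks) (tuples_below (length ks) m)"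
  have y: "y \<ge> 1" using m by (simp add: y_def)
  have g: "growth m \<ge> 1" by (rule growth_ge_1)
  have Y: "Y > 0" by (simp add: Y_def)
  have rhs: "(3/2) ^ q * growth m / y ^ q \<ge> 0" using y g by simp
  consider "ks = []" | "ks \<noteq> []" "m = 1" | "ks \<noteq> []" "m \<ge> 2" using m by force
  then have "S / y ^ k \<le> (3/2) ^ q * growth m / y ^ q / (3/2) ^ sum_list (butlast (k # ks))"
  proof cases
    case 1
    have "1 * 1 \<le> (3/2) ^ q * growth m" using g by (intro mult_mono) auto
    moreover have "y ^ q \<le> y ^ k" using y q by (intro power_increasing) auto
    ultimately have "1 / y ^ k \<le> (3/2) ^ q * growth m / y ^ q"
      using y by (intro frac_le) auto
    then show ?thesis using 1 by (simp add: S_def)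
  next
    case 2
    then have "S = 0" by (cases ks) (auto simp: S_def)
    then show ?thesis using divide_nonneg_nonneg[OF rhs] by simp
  next
    case 3
    have "y \<ge> 3/2" using 3 by (simp add: y_def)
    from inverse_power_le[OF this q]
    have "(growth m / Y) * (1 / y ^ k) \<le> (growth m / Y) * ((3/2) ^ q / y ^ q / (3/2) ^ k)"
      using g Y by (intro mult_left_mono) auto
    moreover have "S * (1 / y ^ k) \<le> (growth m / Y) * (1 / y ^ k)"
      using le y unfolding S_def Y_def by (intro mult_right_mono) auto
    ultimately have "S / y ^ k \<le> (growth m / Y) * ((3/2) ^ q / y ^ q / (3/2) ^ k)" by simp
    also have "\<dots> = (3/2) ^ q * growth m / y ^ q / ((3/2) ^ k * Y)" by (simp add: mult_ac)
    also have "(3/2) ^ k * Y = (3/2) ^ sum_list (butlast (k # ks))"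
      using 3 by (simp add: Y_def power_add)
    finally show ?thesis .
  qed
  then show ?thesis by (simp add: S_def y_def)
qed

text \<open>Induction on the exponents, peeling off the largest entry and keeping one factor
  \<open>1 / (2 * m - 1)\<close> of each power. Exponents 1 are allowed everywhere, so the bound
  must grow with \<open>n\<close>.\<close>

lemma sum_tuples_below_le_growth:
  assumes "\<forall>k\<in>set ks. k > 0" "n \<ge> 1"
  shows "sum (mtv_term ks) (tuples_below (length ks) n) \<le> growth n / (3/2) ^ sum_list (butlast ks)"
  using assms
proof (induction ks arbitrary: n)
  case Nil then show ?case using growth_ge_1 by simp
next
  case (Cons k ks)
  define X :: real where "X = (3/2) ^ sum_list (butlast (k # ks))"
  have X: "X > 0" by (simp add: X_def)
  have "sum (mtv_term ks) (tuples_below (length ks) m) / (2 * real m - 1) ^ k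
      \<le> (3/2) * growth m / (2 * real m - 1) / X" if m: "m \<in> {1..<n}" for m
    using tuples_below_sum_divide_le[of m 1 k ks] Cons.IH[of m] Cons.prems m by (simp add: X_def)
  then have "sum (mtv_term (k # ks)) (tuples_below (length (k # ks)) n) \<le>
      (\<Sum>m=1..<n. (3/2) * growth m / (2 * real m - 1) / X)"
    by (simp only: length_Cons sum_tuples_below_Cons) (rule sum_mono)
  also have "\<dots> = (growth n - 1) / X"
    by (simp only: growth_sum_1[OF Cons.prems(2)] flip: sum_divide_distrib)
  also have "\<dots> \<le> growth n / X" using X by (intro divide_right_mono) auto
  finally show ?case by (simp add: X_def)
qed

text \<open>The constant is \<open>27/2 = 6 * (3/2)\<^sup>2\<close>, with the \<open>6\<close> from \<open>growth_sum_2\<close>.\<close>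

lemma sum_tuples_below_bound:
  assumes "admissible ks"
  shows "sum (mtv_term ks) (tuples_below (length ks) n) \<le> 27/2 / (3/2) ^ sum_list (butlast ks)"
proof (cases "n \<ge> 1")
  case n: True
  obtain k js where ks: "ks = k # js" and k: "k \<ge> 2" and js: "\<forall>j\<in>set js. j > 0"
    using assms by (cases ks) (auto simp: admissible_def)
  define X :: real where "X = (3/2) ^ sum_list (butlast ks)"
  have X: "X > 0" by (simp add: X_def)
  \<comment> \<open>The first exponent is at least 2, so two factors can be kept here; this makes
    the outer sum bounded uniformly in \<open>n\<close>.\<close>
  have "sum (mtv_term js) (tuples_below (length js) m) / (2 * real m - 1) ^ k
      \<le> growth m / (2 * real m - 1)^2 * ((9/4) / X)" if m: "m \<in> {1..<n}" for m
    using tuples_below_sum_divide_le[of m 2 k js] sum_tuples_below_le_growth[of js m] js k m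
    by (simp add: X_def ks power2_eq_square mult_ac)
  then have "sum (mtv_term ks) (tuples_below (length ks) n) \<le>
      (\<Sum>m=1..<n. growth m / (2 * real m - 1)^2 * ((9/4) / X))"
    unfolding ks by (simp only: length_Cons sum_tuples_below_Cons) (rule sum_mono)
  also have "\<dots> = (\<Sum>m=1..<n. growth m / (2 * real m - 1)^2) * ((9/4) / X)"
    by (simp only: sum_distrib_right)
  also have "\<dots> \<le> 6 * ((9/4) / X)"
  proof (rule mult_right_mono)
    have "6 * growth n / (2 * real n - 1) \<ge> 0" using growth_ge_1[of n] n by simp
    then show "(\<Sum>m=1..<n. growth m / (2 * real m - 1)^2) \<le> 6" using growth_sum_2[OF n] by linarith
  qed (use X in auto)
  finally show ?thesis by (simp add: X_def)
next
  case False
  then have "tuples_below (length ks) n = {}"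
    using assms by (cases ks) (auto simp: admissible_def tuples_below_Suc)
  then show ?thesis by simp
qed

section \<open>From truncations to the full series\<close>

lemma finite_subset_tuples_below:
  assumes "finite F" "F \<subseteq> tuples d"
  obtains n where "F \<subseteq> tuples_below d n"
proof
  have "finite (\<Union>(set ` F))" using assms by blast
  then have "\<forall>m\<in>\<Union>(set ` F). m < Suc (Max (\<Union>(set ` F)))"
    using Max_ge by (auto simp: less_Suc_eq_le)
  then show "F \<subseteq> tuples_below d (Suc (Max (\<Union>(set ` F))))"
    using assms by (auto simp: tuples_below_def)
qed

lemma finite_sum_mtv_term_le:
  assumes "admissible ks" "finite F" "F \<subseteq> tuples (length ks)"
  shows "sum (mtv_term ks) F \<le> 27/2 / (3/2) ^ sum_list (butlast ks)"
proof -
  obtain n where n: "F \<subseteq> tuples_below (length ks) n"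
    using finite_subset_tuples_below[OF assms(2,3)] by blast
  have "sum (mtv_term ks) F \<le> sum (mtv_term ks) (tuples_below (length ks) n)"
    using n by (intro sum_mono2 finite_tuples_below) (auto simp: tuples_below_def intro: less_imp_le mtv_term_pos)
  also note sum_tuples_below_bound[OF assms(1)]
  finally show ?thesis .
qed

lemma summable_mtv_term:
  assumes "admissible ks"
  shows "mtv_term ks summable_on tuples (length ks)"
proof (rule nonneg_bdd_above_summable_on)
  show "bdd_above (sum (mtv_term ks) ` {F. F \<subseteq> tuples (length ks) \<and> finite F})"
    using finite_sum_mtv_term_le[OF assms] by (intro bdd_aboveI2) auto
qed (simp add: mtv_term_pos less_imp_le)

text \<open>The right-hand side ignores the last exponent, so one bound serves the whole sequence
  obtained by varying it.\<close>

lemma mtv_le: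
  assumes "admissible ks"
  shows "mtv ks \<le> 27/2 / (3/2) ^ sum_list (butlast ks)"
  unfolding mtv_eq_infsum
  using infsum_le_finite_sums[OF summable_mtv_term[OF assms]] finite_sum_mtv_term_le[OF assms] by blast

section \<open>Dependence on the last exponent\<close>

lemma infsum_pos:
  fixes f :: "'a \<Rightarrow> real"
  assumes "f summable_on A" "\<And>x. x \<in> A \<Longrightarrow> f x > 0" "A \<noteq> {}"
  shows "infsum f A > 0"
proof -
  obtain a where a: "a \<in> A" using assms by blast
  have "sum f {a} \<le> infsum f A"
    using assms a by (intro finite_sum_le_infsum) (auto intro: less_imp_le)
  with assms(2)[OF a] show ?thesis by simp
qed

text \<open>The tuples with \<open>u = 1\<close> contribute the limit; the rest shrinks by a factor \<open>1/3\<close> at each step.\<close>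

lemma infsum_mult_power_decreasing:
  fixes w u :: "'a \<Rightarrow> real"
  assumes summable: "w summable_on A" and w: "\<And>x. x \<in> A \<Longrightarrow> w x > 0"
    and u: "\<And>x. x \<in> A \<Longrightarrow> u x = 1 \<or> 0 < u x \<and> u x \<le> 1/3"
    and ex: "\<exists>x\<in>A. u x = 1" "\<exists>x\<in>A. u x \<noteq> 1"
  defines "f \<equiv> \<lambda>k. infsum (\<lambda>x. w x * u x ^ k) A"
  shows "f (Suc k) < f k" and "\<exists>l>0. f \<longlonglongrightarrow> l"
proof -
  define A1 A2 where "A1 = {x\<in>A. u x = 1}" and "A2 = {x\<in>A. u x \<noteq> 1}"
  have A: "A = A1 \<union> A2" "A1 \<inter> A2 = {}" by (auto simp: A1_def A2_def)
  have u_bounds: "0 < u x" "u x \<le> 1" if "x \<in> A" for x using u[OF that] by auto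
  have summ: "(\<lambda>x. w x * u x ^ k) summable_on A" for k
  proof (rule summable_on_comparison_test[OF summable])
    fix x assume x: "x \<in> A"
    show "w x * u x ^ k \<le> w x" "0 \<le> w x * u x ^ k"
      using w[OF x] u_bounds[OF x] by (auto simp: mult_le_cancel_left1 power_le_one less_imp_le)
  qed
  have summ1: "(\<lambda>x. w x * u x ^ k) summable_on A1" and summ2: "(\<lambda>x. w x * u x ^ k) summable_on A2" for k
    using summable_on_subset_banach[OF summ] A by auto
  define l where "l = infsum w A1"
  define R where "R k = infsum (\<lambda>x. w x * u x ^ k) A2" for k
  have f: "f k = l + R k" for k
  proof -
    have "f k = infsum (\<lambda>x. w x * u x ^ k) A1 + R k"
      unfolding f_def R_def A(1) by (rule infsum_Un_disjoint[OF summ1 summ2 A(2)])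
    also have "infsum (\<lambda>x. w x * u x ^ k) A1 = l"
      unfolding l_def by (rule infsum_cong) (simp add: A1_def)
    finally show ?thesis .
  qed
  have "l > 0"
    unfolding l_def using summ1[of 0] ex(1) w by (intro infsum_pos) (auto simp: A1_def)
  have R_pos: "R k > 0" for k
    unfolding R_def using summ2 ex(2) w u_bounds by (intro infsum_pos) (auto simp: A2_def)
  have R_Suc: "R (Suc k) \<le> R k * (1/3)" for k
  proof -
    have "R (Suc k) \<le> infsum (\<lambda>x. w x * u x ^ k * (1/3)) A2"
      unfolding R_def
    proof (rule infsum_mono)
      fix x assume x: "x \<in> A2"
      then have "w x * u x ^ k \<ge> 0" "u x \<le> 1/3"
        using w[of x] u_bounds[of x] u[of x] by (auto simp: A2_def)
      then have "(w x * u x ^ k) * u x \<le> (w x * u x ^ k) * (1/3)" by (intro mult_left_mono)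
      then show "w x * u x ^ Suc k \<le> w x * u x ^ k * (1/3)" by (simp add: ac_simps)
    qed (use summ2 summable_on_cmult_left in blast)+
    also have "\<dots> = R k * (1/3)" unfolding R_def by (rule infsum_cmult_left) (use summ2 in auto)
    finally show ?thesis .
  qed
  show "f (Suc k) < f k" using R_Suc[of k] R_pos[of k] by (simp add: f)
  have R_le: "R k \<le> R 0 * (1/3) ^ k" for k
  proof (induction k)
    case (Suc k)
    then show ?case using R_Suc[of k] by simp
  qed simp
  have "(\<lambda>k. R 0 * (1/3) ^ k) \<longlonglongrightarrow> 0"
    by (intro tendsto_mult_right_zero LIMSEQ_realpow_zero) auto
  from tendsto_sandwich[OF _ _ tendsto_const this] have "R \<longlonglongrightarrow> 0"
    using R_le R_pos by (auto intro!: always_eventually less_imp_le)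
  then have "f \<longlonglongrightarrow> l + 0" unfolding f by (intro tendsto_add tendsto_const)
  then show "\<exists>l>0. f \<longlonglongrightarrow> l" using \<open>l > 0\<close> by auto
qed

text \<open>Splitting the last exponent as \<open>k + q\<close> leaves a fixed weight, summable when
  \<open>p @ [q]\<close> is admissible, times a \<open>k\<close>-th power.\<close>

lemma mtv_term_snoc_power:
  assumes "ms \<in> tuples (Suc (length p))"
  shows "mtv_term (p @ [k + q]) ms = mtv_term (p @ [q]) ms * (1 / (2 * real (last ms) - 1)) ^ k"
proof -
  obtain ns m where ms: "ms = ns @ [m]" "length ns = length p"
    using assms by (auto simp: tuples_def length_Suc_conv_rev)
  then show ?thesis by (simp add: mtv_term_snoc power_add power_one_over)
qed

text \<open>Supplies tuples of any positive length ending in a prescribed entry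
  \<open>i\<close>.\<close>

lemma rev_upt_mem_tuples: "0 < i \<Longrightarrow> rev [i..<i + d] \<in> tuples d"
  by (auto simp: tuples_def sorted_wrt_rev)

text \<open>The ratio \<open>u\<close> is 1 when the last entry is 1 and at most \<open>1/3\<close>
  otherwise; both cases occur, by tuples ending in 1 and in 2.\<close>

lemma mtv_snoc_decreasing:
  assumes adm: "admissible (p @ [q])"
  shows "mtv (p @ [Suc k + q]) < mtv (p @ [k + q])"
    and "\<exists>l>0. (\<lambda>k. mtv (p @ [k + q])) \<longlonglongrightarrow> l"
proof -
  define D where "D = tuples (Suc (length p))"
  define u where "u ms = 1 / (2 * real (last ms) - 1)" for ms :: "nat list"
  have eq: "mtv (p @ [k + q]) = infsum (\<lambda>ms. mtv_term (p @ [q]) ms * u ms ^ k) D" for k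
    unfolding mtv_eq_infsum u_def D_def
    by (simp only: length_append_singleton) (rule infsum_cong, rule mtv_term_snoc_power)
  have summ: "mtv_term (p @ [q]) summable_on D"
    using summable_mtv_term[OF adm] by (simp add: D_def)
  have pos: "mtv_term (p @ [q]) ms > 0" if "ms \<in> D" for ms
    using mtv_term_pos[of ms "p @ [q]"] that by (simp add: D_def)
  have u: "u ms = 1 \<or> 0 < u ms \<and> u ms \<le> 1/3" if "ms \<in> D" for ms
  proof -
    have "last ms \<in> set ms" using that by (intro last_in_set) (auto simp: D_def tuples_def)
    then have "last ms > 0" using that by (auto simp: D_def tuples_def)
    then consider "last ms = 1" | "last ms \<ge> 2" by linarith
    then show ?thesis by cases (auto simp: u_def field_simps)
  qed
  have last: "last (rev [i..<i + Suc d]) = i" for i d :: nat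
    by (simp add: last_rev del: upt_Suc)
  have ex1: "\<exists>ms\<in>D. u ms = 1"
    unfolding D_def by (rule bexI[OF _ rev_upt_mem_tuples[of 1]]) (simp_all only: u_def last, simp_all)
  have ex2: "\<exists>ms\<in>D. u ms \<noteq> 1"
    unfolding D_def by (rule bexI[OF _ rev_upt_mem_tuples[of 2]]) (simp_all only: u_def last, simp_all)
  note * = infsum_mult_power_decreasing[OF summ pos u ex1 ex2]
  show "mtv (p @ [Suc k + q]) < mtv (p @ [k + q])" unfolding eq by (rule *(1))
  show "\<exists>l>0. (\<lambda>k. mtv (p @ [k + q])) \<longlonglongrightarrow> l" unfolding eq by (rule *(2))
qed

section \<open>The order type\<close>

text \<open>Positivity of the entries bounds the length by the sum.\<close>

lemma finite_lists_sum_le: "finite {p :: nat list. (\<forall>k\<in>set p. k > 0) \<and> sum_list p \<le> W}"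
proof (rule finite_subset)
  have "length p \<le> sum_list p" if "\<forall>k\<in>set p. k > 0" for p :: "nat list"
    using that by (induction p) auto
  then show "{p :: nat list. (\<forall>k\<in>set p. k > 0) \<and> sum_list p \<le> W} \<subseteq>
      {p. set p \<subseteq> {..W} \<and> length p \<le> W}"
    using member_le_sum_list by (auto intro: order_trans)
qed (simp add: finite_lists_length_le)

theorem theorem1p3:
  "well_order_on mtv_set (geq_on mtv_set) \<and> (geq_on mtv_set, omega_squared) \<in> ordIso"
proof -
  \<comment> \<open>Prefixes left after removing the last exponent; the empty one comes from depth
    one.\<close>
  define I where "I = {p. p = [] \<or> admissible p}"
  \<comment> \<open>The least possible last exponent: 2 if it is also the first one, otherwise
    1.\<close>
  define q :: "nat list \<Rightarrow> nat" where "q p = (if p = [] then 2 else 1)" for p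
  define s where "s p k = mtv (p @ [k + q p])" for p k
  have adm: "admissible (p @ [k + q p])" if "p \<in> I" for p k
    using that by (cases p) (auto simp: I_def q_def admissible_def)
  have adm0: "admissible (p @ [q p])" if "p \<in> I" for p
    using adm[OF that, of 0] by simp
  have "\<forall>p\<in>I. \<exists>l>0. s p \<longlonglongrightarrow> l"
    unfolding s_def using mtv_snoc_decreasing(2) adm0 by blast
  then obtain l where l: "\<And>p. p \<in> I \<Longrightarrow> 0 < l p" "\<And>p. p \<in> I \<Longrightarrow> s p \<longlonglongrightarrow> l p"
    by metis
  have dec: "s p (Suc k) < s p k" if "p \<in> I" for p k
    unfolding s_def using mtv_snoc_decreasing(1)[OF adm0[OF that]] .
  have "infinite I"
  proof
    assume "finite I"
    moreover have "(\<lambda>k. [k + 2]) ` UNIV \<subseteq> I" by (auto simp: I_def admissible_def)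
    ultimately have "finite ((\<lambda>k::nat. [k + 2]) ` UNIV)" using finite_subset by blast
    then show False by (simp add: finite_image_iff inj_on_def)
  qed
  have fin: "finite {p\<in>I. \<epsilon> \<le> s p 0}" if \<epsilon>: "0 < \<epsilon>" for \<epsilon>
  proof -
    \<comment> \<open>Beyond this weight the bound \<open>27/2 / (3/2) ^ sum_list p\<close> is below
      \<open>\<epsilon>\<close>, leaving finitely many prefixes.\<close>
    obtain W where W: "27/2 / \<epsilon> < (3/2) ^ W"
      using real_arch_pow[of "3/2" "27/2 / \<epsilon>"] by auto
    have "sum_list p \<le> W" if "p \<in> I" "\<epsilon> \<le> s p 0" for p
    proof (rule ccontr)
      assume "\<not> sum_list p \<le> W"
      then have "(3/2 :: real) ^ W \<le> (3/2) ^ sum_list p" by (intro power_increasing) auto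
      moreover have "\<epsilon> \<le> 27/2 / (3/2) ^ sum_list p"
        using mtv_le[OF adm0[OF that(1)]] that(2) by (simp add: s_def)
      then have "(3/2) ^ sum_list p \<le> 27/2 / \<epsilon>" using \<epsilon> by (simp add: field_simps)
      ultimately show False using W by linarith
    qed
    then have "{p\<in>I. \<epsilon> \<le> s p 0} \<subseteq> {p. (\<forall>k\<in>set p. k > 0) \<and> sum_list p \<le> W}"
      by (auto simp: I_def admissible_def)
    then show ?thesis using finite_lists_sum_le finite_subset by blast
  qed
  have set_eq: "mtv_set = (\<Union>p\<in>I. range (s p))"
  proof
    show "(\<Union>p\<in>I. range (s p)) \<subseteq> mtv_set" using adm by (auto simp: mtv_set_def s_def)
    show "mtv_set \<subseteq> (\<Union>p\<in>I. range (s p))"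
    proof
      fix x assume "x \<in> mtv_set"
      then obtain ks where ks: "admissible ks" "x = mtv ks" by (auto simp: mtv_set_def)
      then obtain p k where p: "ks = p @ [k]" by (cases ks rule: rev_cases) (auto simp: admissible_def)
      have "p \<in> I" using ks p by (cases p) (auto simp: I_def admissible_def)
      \<comment> \<open>Guarantees that the natural subtraction \<open>k - q p\<close> is not
        truncated.\<close>
      moreover have "q p \<le> k" using ks p by (cases p) (auto simp: q_def admissible_def)
      then have "x = s p (k - q p)" by (simp add: s_def ks p)
      ultimately show "x \<in> (\<Union>p\<in>I. range (s p))" by blast
    qed
  qed
  show ?thesis
    using omega_squared_enumeration[OF \<open>infinite I\<close> dec l(2) l(1) fin] geq_on_ordIso_omega_squared
    unfolding set_eq by blast
qed

end
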